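(* Let $d \le \omega$ and let $Y$ be a metric space. If $f \colon (2^\omega)^d \to Y$ is $(v^d)$-measurable, then for any Silver $d$-cube $P = \prod_{m \in d} [h_m]$ there exists a Silver $d$-cube $Q \subseteq P$ such that $f|_Q$ is continuous.
   Context: Here $d \le \omega$ is a natural number or $\omega$, identified with $\{m : m < d\}$. For $D \subseteq \omega$ and $h \colon D \to 2$ put $[h] = \{x \in 2^\omega : \forall n \in D,\ x(n) = h(n)\}$. A Silver $d$-cube is a set $\prod_{m \in d} [h_m] \subseteq (2^\omega)^d$ where each $h_m \in 2^{D_m}$ and each $D_m \subseteq \omega$ is coinfinite (i.e. $\omega\setminus D_m$ is infinite). A set $A \subseteq (2^\omega)^d$ has the $(v^d)$-property (written $A \in v^d$) if for every Silver $d$-cube $P$ there is a Silver $d$-cube $Q \subseteq P$ such that $Q \subseteq A$ or $Q \subseteq (2^\omega)^d \setminus A$. A function $f \colon (2^\omega)^d \to Y$ into a metric space is $(v^d)$-measurable if $f^{-1}(U) \in v^d$ for every open $U \subseteq Y$. Continuity of $f|_Q$ refers to the subspace topology on $Q$ inherited from the product topology. *)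

theory Defs
  imports "HOL-Analysis.Analysis" "HOL-Library.Extended_Nat"
begin

definition index_set :: "enat \<Rightarrow> nat set" where
  "index_set d = {m. enat m < d}"

definition cantor_topology :: "(nat \<Rightarrow> bool) topology" where
  "cantor_topology = product_topology (\<lambda>_. discrete_topology UNIV) UNIV"

(* Points of the d-th power of the Cantor space are functions that are
   undefined outside index_set d. *)
definition cantor_power :: "enat \<Rightarrow> (nat \<Rightarrow> nat \<Rightarrow> bool) topology" where
  "cantor_power d = product_topology (\<lambda>_. cantor_topology) (index_set d)"

(* A function h from D to 2 is a partial map with dom h = D. *)
definition cylinder :: "(nat \<rightharpoonup> bool) \<Rightarrow> (nat \<Rightarrow> bool) set" where
  "cylinder h = {x. \<forall>n\<in>dom h. h n = Some (x n)}"

definition silver_cube :: "enat \<Rightarrow> (nat \<Rightarrow> nat \<Rightarrow> bool) set \<Rightarrow> bool" where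
  "silver_cube d P \<longleftrightarrow>
    (\<exists>h. (\<forall>m\<in>index_set d. infinite (- dom (h m))) \<and>
         P = (\<Pi>\<^sub>E m\<in>index_set d. cylinder (h m)))"

definition v_property :: "enat \<Rightarrow> (nat \<Rightarrow> nat \<Rightarrow> bool) set \<Rightarrow> bool" where
  "v_property d A \<longleftrightarrow>
    A \<subseteq> topspace (cantor_power d) \<and>
    (\<forall>P. silver_cube d P \<longrightarrow>
      (\<exists>Q. silver_cube d Q \<and> Q \<subseteq> P \<and>
           (Q \<subseteq> A \<or> Q \<subseteq> topspace (cantor_power d) - A)))"

definition v_measurable ::
  "enat \<Rightarrow> 'y topology \<Rightarrow> ((nat \<Rightarrow> nat \<Rightarrow> bool) \<Rightarrow> 'y) \<Rightarrow> bool" where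
  "v_measurable d Y f \<longleftrightarrow>
    f \<in> topspace (cantor_power d) \<rightarrow> topspace Y \<and>
    (\<forall>U. openin Y U \<longrightarrow> v_property d {x \<in> topspace (cantor_power d). f x \<in> U})"

end

theory Submission
  imports Defs
begin

text \<open>
  The engine is fusion. If each requirement R n is inherited by subsets and can be met inside every
  Silver subcube of P, then one Silver cube Q \<open>\<subseteq>\<close> P meets all of them locally: for every n there is a
  finite set F n of coordinates such that each slice of Q obtained by prescribing the values on F n
  satisfies R n (lemma \<open>fusion\<close>). Such slices are relatively open in Q. So if every Silver cube contains
  one whose image under f has diameter as small as desired, fusion yields a cube on which f is
  continuous. It remains to find these cubes with small image.

  If Y is separable they come from a countable cover of Y by small balls: by fusion, a cube covered by
  countably many sets with the property \<open>v\<^sup>d\<close> has a subcube inside one of them (lemma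
  \<open>subcube_inside_countable_cover\<close>). A general metric space has, following A. H. Stone, a cover by small
  open sets which splits into countably many pairwise disjoint families
  (lemma \<open>sigma_disjoint_open_cover\<close>). The unions of these families again form a countable open cover,
  so on some subcube f takes values in the union of a single disjoint family. Let g x be the
  index of the member that contains f x. Every union of members is open, hence every preimage of a
  set of indices under g is measurable, and all that is needed is a subcube on which g is constant.

  Suppose that there is none (lemma \<open>constant_on_subcube\<close>). Since a cube has at most continuum many
  points, g may be taken to have values in the Cantor space, and after fusion g is continuous. The image of each
  subcube is then compact, and it has no isolated point, because an isolated point would have a
  constant slice above it; hence it has the size of the continuum. There are only continuum many
  subcubes, so Bernstein's argument selects two distinct values in the image of each subcube, all
  selected values being different. The set B of all first choices meets the image of every subcube and contains
  none of them, although the preimage of B is measurable: a contradiction.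
\<close>

section \<open>Silver cubes and their conditions\<close>

definition silver_condition :: "enat \<Rightarrow> (nat \<Rightarrow> nat \<rightharpoonup> bool) \<Rightarrow> bool" where
  "silver_condition d h \<longleftrightarrow> (\<forall>m\<in>index_set d. infinite (- dom (h m)))"

definition cube :: "enat \<Rightarrow> (nat \<Rightarrow> nat \<rightharpoonup> bool) \<Rightarrow> (nat \<Rightarrow> nat \<Rightarrow> bool) set" where
  "cube d h = (\<Pi>\<^sub>E m\<in>index_set d. cylinder (h m))"

definition agreeing_on :: "(nat \<times> nat) set \<Rightarrow> (nat \<Rightarrow> nat \<Rightarrow> bool) \<Rightarrow> (nat \<Rightarrow> nat \<Rightarrow> bool) set" where
  "agreeing_on F x = {y. \<forall>(m, k)\<in>F. y m k = x m k}"

definition free_coordinates :: "enat \<Rightarrow> (nat \<Rightarrow> nat \<rightharpoonup> bool) \<Rightarrow> (nat \<times> nat) set" where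
  "free_coordinates d h = {(m, k). m \<in> index_set d \<and> h m k = None}"

lemma silver_cube_iff: "silver_cube d P \<longleftrightarrow> (\<exists>h. silver_condition d h \<and> P = cube d h)"
  by (simp add: silver_cube_def silver_condition_def cube_def)

lemma cylinder_nonempty: "cylinder h \<noteq> {}"
proof -
  have "(\<lambda>n. the (h n)) \<in> cylinder h"
    by (auto simp: cylinder_def)
  then show ?thesis by blast
qed

lemma silver_cube_nonempty: "silver_cube d P \<Longrightarrow> P \<noteq> {}"
  by (auto simp: silver_cube_def PiE_eq_empty_iff cylinder_nonempty)

lemma topspace_cantor_power: "topspace (cantor_power d) = (\<Pi>\<^sub>E m\<in>index_set d. UNIV)"
  by (simp add: cantor_power_def cantor_topology_def)

lemma silver_cube_subset_topspace: "silver_cube d P \<Longrightarrow> P \<subseteq> topspace (cantor_power d)"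
  unfolding silver_cube_def topspace_cantor_power by (auto simp: PiE_iff)

lemma mem_cube_iff:
  "y \<in> cube d h \<longleftrightarrow>
     y \<in> extensional (index_set d) \<and> (\<forall>m\<in>index_set d. \<forall>k b. h m k = Some b \<longrightarrow> y m k = b)"
proof -
  have "y m \<in> cylinder (h m) \<longleftrightarrow> (\<forall>k b. h m k = Some b \<longrightarrow> y m k = b)" for m
    by (auto simp: cylinder_def dom_def)
  then show ?thesis
    by (simp add: cube_def PiE_iff conj_commute)
qed

lemma cube_mono:
  assumes "\<And>m. m \<in> index_set d \<Longrightarrow> h m \<subseteq>\<^sub>m h' m"
  shows "cube d h' \<subseteq> cube d h"
proof
  fix y assume y: "y \<in> cube d h'"
  have "h' m k = Some b" if "m \<in> index_set d" "h m k = Some b" for m k b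
    using assms[OF that(1)] that(2) by (metis domI map_le_def)
  with y show "y \<in> cube d h"
    unfolding mem_cube_iff by blast
qed

text \<open>A coordinate that is left free, or fixed to another value, by the smaller cube would be
  witnessed by a point of the smaller cube outside the larger one.\<close>

lemma cube_subset_imp_map_le:
  assumes "cube d h' \<subseteq> cube d h" "m \<in> index_set d"
  shows "h m \<subseteq>\<^sub>m h' m"
proof -
  have sub: "cylinder (h' m) \<subseteq> cylinder (h m)"
    using assms cylinder_nonempty unfolding cube_def subset_PiE by (auto simp: PiE_eq_empty_iff)
  show ?thesis
    unfolding map_le_def
  proof
    fix k assume "k \<in> dom (h m)"
    then obtain b where b: "h m k = Some b" by auto
    define x where "x = (\<lambda>n. case h' m n of None \<Rightarrow> \<not> b | Some c \<Rightarrow> c)"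
    have "x \<in> cylinder (h' m)"
      by (auto simp: x_def cylinder_def)
    with sub have "x \<in> cylinder (h m)" by blast
    with b have "x k = b" by (force simp: cylinder_def)
    with b show "h m k = h' m k"
      by (auto simp: x_def split: option.splits)
  qed
qed

text \<open>Prescribing finitely many coordinates leaves infinitely many free ones.\<close>

lemma silver_cube_agreeing_on:
  assumes P: "silver_cube d P" and "x \<in> P" "finite F" "F \<subseteq> index_set d \<times> UNIV"
  shows "silver_cube d (P \<inter> agreeing_on F x)"
proof -
  obtain h where h: "silver_condition d h" "P = cube d h"
    using P by (auto simp: silver_cube_iff)
  define h' where "h' = (\<lambda>m k. if (m, k) \<in> F then Some (x m k) else h m k)"
  have "silver_condition d h'"
    unfolding silver_condition_def
  proof
    fix m assume "m \<in> index_set d"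
    then have "infinite (- dom (h m) - snd ` F)"
      using h \<open>finite F\<close> by (auto simp: silver_condition_def)
    moreover have "- dom (h m) - snd ` F \<subseteq> - dom (h' m)"
      by (force simp: h'_def image_iff domIff split: if_splits)
    ultimately show "infinite (- dom (h' m))"
      using finite_subset by blast
  qed
  moreover have "P \<inter> agreeing_on F x = cube d h'"
    using assms(2,4) unfolding h
    by (fastforce simp: mem_cube_iff agreeing_on_def h'_def split: if_splits)
  ultimately show ?thesis
    by (auto simp: silver_cube_iff)
qed

lemma openin_agreeing_on:
  assumes "finite F" "F \<subseteq> index_set d \<times> UNIV"
  shows "openin (cantor_power d) (topspace (cantor_power d) \<inter> agreeing_on F x)"
  using assms
proof (induction F)
  case empty
  then show ?case by (simp add: agreeing_on_def)
next
  case (insert p F)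
  obtain m k where p: "p = (m, k)" by fastforce
  with insert.prems have m: "m \<in> index_set d" by auto
  have "continuous_map (cantor_power d) (discrete_topology UNIV) (\<lambda>y. y m k)"
    using continuous_map_compose[of "cantor_power d" cantor_topology "\<lambda>y. y m"
        "discrete_topology UNIV" "\<lambda>z. z k"] m
      continuous_map_product_projection[of m "index_set d" "\<lambda>_. cantor_topology"]
      continuous_map_product_projection[of k UNIV "\<lambda>_::nat. discrete_topology (UNIV::bool set)"]
    by (simp add: cantor_power_def cantor_topology_def o_def)
  then have "openin (cantor_power d) {y \<in> topspace (cantor_power d). y m k \<in> {x m k}}"
    by (rule openin_continuous_map_preimage) auto
  moreover have "topspace (cantor_power d) \<inter> agreeing_on (insert p F) x =
      (topspace (cantor_power d) \<inter> agreeing_on F x) \<inter> {y \<in> topspace (cantor_power d). y m k \<in> {x m k}}"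
    by (auto simp: agreeing_on_def p)
  ultimately show ?case
    using insert by auto
qed

lemma openin_subtopology_agreeing_on:
  assumes "silver_cube d Q" "finite F" "F \<subseteq> index_set d \<times> UNIV"
  shows "openin (subtopology (cantor_power d) Q) (Q \<inter> agreeing_on F x)"
proof -
  have "Q \<inter> agreeing_on F x = topspace (cantor_power d) \<inter> agreeing_on F x \<inter> Q"
    using silver_cube_subset_topspace[OF assms(1)] by auto
  then show ?thesis
    using openin_agreeing_on[OF assms(2,3)] by (metis openin_subtopology_Int)
qed


section \<open>Fusion\<close>

text \<open>
  Amalgamation for one assignment on F: shrink the slice given by x to meet R, keep the new values
  outside F, and set the coordinates in F free again. The slice given by x is then
  contained in the cube just found, while the other slices have merely shrunk.
\<close>

lemma amalgamate_one:
  assumes h: "silver_condition d h" and F: "finite F" "F \<subseteq> free_coordinates d h"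
    and dense: "\<And>Q. silver_cube d Q \<Longrightarrow> Q \<subseteq> cube d h \<Longrightarrow> \<exists>Q'. silver_cube d Q' \<and> Q' \<subseteq> Q \<and> R Q'"
    and down: "\<And>Q Q'. R Q \<Longrightarrow> Q' \<subseteq> Q \<Longrightarrow> R Q'"
  shows "\<exists>h'. silver_condition d h' \<and> cube d h' \<subseteq> cube d h \<and> F \<subseteq> free_coordinates d h' \<and>
           R (cube d h' \<inter> agreeing_on F x)"
proof -
  have FI: "F \<subseteq> index_set d \<times> UNIV"
    using F by (auto simp: free_coordinates_def)
  \<comment> \<open>Once restricted to the index set, this is a point of the cube with the values of x on F, so
    the slice given by x is again a Silver cube.\<close>
  define x' where "x' = (\<lambda>m k. if (m, k) \<in> F then x m k else the (h m k))"
  define x'' where "x'' = restrict x' (index_set d)"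
  have x'': "x'' \<in> cube d h"
    using F by (auto simp: mem_cube_iff x''_def x'_def free_coordinates_def)
  have ag: "agreeing_on F x'' = agreeing_on F x"
    using FI by (force simp: agreeing_on_def x''_def x'_def)
  have "silver_cube d (cube d h)"
    using h by (auto simp: silver_cube_iff)
  then have "silver_cube d (cube d h \<inter> agreeing_on F x)"
    using silver_cube_agreeing_on[OF _ x'' F(1) FI] ag by simp
  then obtain Q where Q: "silver_cube d Q" "Q \<subseteq> cube d h \<inter> agreeing_on F x" "R Q"
    using dense[of "cube d h \<inter> agreeing_on F x"] by blast
  then obtain h2 where h2: "silver_condition d h2" "Q = cube d h2"
    by (auto simp: silver_cube_iff)
  define h' where "h' = (\<lambda>m k. if (m, k) \<in> F then None else h2 m k)"
  have "- dom (h2 m) \<subseteq> - dom (h' m)" for m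
    by (auto simp: h'_def split: if_splits)
  then have "silver_condition d h'"
    using h2(1) unfolding silver_condition_def by (meson finite_subset)
  moreover have "cube d h' \<subseteq> cube d h"
  proof (rule cube_mono)
    fix m assume m: "m \<in> index_set d"
    then have "h m \<subseteq>\<^sub>m h2 m"
      using Q h2 by (intro cube_subset_imp_map_le) auto
    then show "h m \<subseteq>\<^sub>m h' m"
      using F unfolding map_le_def h'_def free_coordinates_def by auto
  qed
  moreover have "F \<subseteq> free_coordinates d h'"
    using FI by (auto simp: free_coordinates_def h'_def)
  moreover have "cube d h' \<inter> agreeing_on F x \<subseteq> cube d h2"
  proof
    fix y assume y: "y \<in> cube d h' \<inter> agreeing_on F x"
    obtain z where z: "z \<in> cube d h2"
      using silver_cube_nonempty Q h2 by blast
    show "y \<in> cube d h2"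
      unfolding mem_cube_iff
    proof (intro conjI ballI allI impI)
      show "y \<in> extensional (index_set d)"
        using y by (simp add: mem_cube_iff)
      fix m k b assume *: "m \<in> index_set d" "h2 m k = Some b"
      show "y m k = b"
      proof (cases "(m, k) \<in> F")
        case True
        have "z m k = b"
          using z * by (auto simp: mem_cube_iff)
        moreover have "z \<in> agreeing_on F x"
          using z Q h2 by auto
        ultimately show ?thesis
          using y True by (auto simp: agreeing_on_def)
      next
        case False
        then show ?thesis
          using y * by (auto simp: mem_cube_iff h'_def)
      qed
    qed
  qed
  then have "R (cube d h' \<inter> agreeing_on F x)"
    using Q h2 down by blast
  ultimately show ?thesis by blast
qed

text \<open>The finitely many assignments on F are treated one after the other; inheritance of R by subsets
  preserves what has been achieved for the earlier ones.\<close>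

lemma amalgamate:
  assumes h: "silver_condition d h" and F: "finite F" "F \<subseteq> free_coordinates d h"
    and dense: "\<And>Q. silver_cube d Q \<Longrightarrow> Q \<subseteq> cube d h \<Longrightarrow> \<exists>Q'. silver_cube d Q' \<and> Q' \<subseteq> Q \<and> R Q'"
    and down: "\<And>Q Q'. R Q \<Longrightarrow> Q' \<subseteq> Q \<Longrightarrow> R Q'"
  shows "\<exists>h'. silver_condition d h' \<and> cube d h' \<subseteq> cube d h \<and> F \<subseteq> free_coordinates d h' \<and>
           (\<forall>x. R (cube d h' \<inter> agreeing_on F x))"
proof -
  let ?char = "\<lambda>S m k. (m, k) \<in> S"
  have "\<exists>h'. silver_condition d h' \<and> cube d h' \<subseteq> cube d h \<and> F \<subseteq> free_coordinates d h' \<and>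
           (\<forall>S\<in>\<S>. R (cube d h' \<inter> agreeing_on F (?char S)))" if "finite \<S>" for \<S>
    using that
  proof induction
    case empty
    then show ?case using h F by blast
  next
    case (insert S \<S>)
    then obtain h1 where h1: "silver_condition d h1" "cube d h1 \<subseteq> cube d h"
      "F \<subseteq> free_coordinates d h1" "\<forall>S\<in>\<S>. R (cube d h1 \<inter> agreeing_on F (?char S))"
      by blast
    have "\<exists>h'. silver_condition d h' \<and> cube d h' \<subseteq> cube d h1 \<and> F \<subseteq> free_coordinates d h' \<and>
           R (cube d h' \<inter> agreeing_on F (?char S))"
    proof (rule amalgamate_one[where R = R, OF h1(1) F(1) h1(3)])
      show "R Q'" if "R Q" "Q' \<subseteq> Q" for Q Q'
        using that by (rule down)
      show "\<exists>Q'. silver_cube d Q' \<and> Q' \<subseteq> Q \<and> R Q'" if "silver_cube d Q" "Q \<subseteq> cube d h1" for Q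
        using that h1(2) by (intro dense) auto
    qed
    then obtain h' where h': "silver_condition d h'" "cube d h' \<subseteq> cube d h1"
      "F \<subseteq> free_coordinates d h'" "R (cube d h' \<inter> agreeing_on F (?char S))"
      by blast
    have "R (cube d h' \<inter> agreeing_on F (?char T))" if "T \<in> \<S>" for T
    proof (rule down)
      show "R (cube d h1 \<inter> agreeing_on F (?char T))"
        using h1(4) that by blast
      show "cube d h' \<inter> agreeing_on F (?char T) \<subseteq> cube d h1 \<inter> agreeing_on F (?char T)"
        using h'(2) by blast
    qed
    then show ?case
      using h1(2) h' by (intro exI[of _ h']) auto
  qed
  from this[of "Pow F"] F(1) obtain h' where h': "silver_condition d h'" "cube d h' \<subseteq> cube d h"
    "F \<subseteq> free_coordinates d h'" "\<forall>S\<in>Pow F. R (cube d h' \<inter> agreeing_on F (?char S))"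
    by auto
  have "R (cube d h' \<inter> agreeing_on F x)" for x
  proof -
    define S where "S = {(m, k) \<in> F. x m k}"
    have "R (cube d h' \<inter> agreeing_on F (?char S))"
      using h'(4) by (rule bspec) (auto simp: S_def)
    moreover have "agreeing_on F (?char S) = agreeing_on F x"
      by (force simp: agreeing_on_def S_def)
    ultimately show ?thesis
      by simp
  qed
  then show ?thesis using h' by blast
qed

text \<open>
  The conditions h n increase while the finite sets F n of coordinates promised to stay free
  increase as well; R n is met on all slices over F n before F n is enlarged. The union of the
  conditions leaves every F n free. That it still has infinitely many free coordinates in every
  factor is ensured by bookkeeping: stage n adds, for each factor m \<open>\<le>\<close> n, a free coordinate k \<open>\<ge>\<close> n. Only finitely
  many factors are treated at a time, which is why d = \<open>\<omega>\<close> is no harder than finite d.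
\<close>

lemma fusion:
  fixes R :: "nat \<Rightarrow> (nat \<Rightarrow> nat \<Rightarrow> bool) set \<Rightarrow> bool"
  assumes P: "silver_cube d P"
    and dense: "\<And>n Q. silver_cube d Q \<Longrightarrow> Q \<subseteq> P \<Longrightarrow> \<exists>Q'. silver_cube d Q' \<and> Q' \<subseteq> Q \<and> R n Q'"
    and down: "\<And>n Q Q'. R n Q \<Longrightarrow> Q' \<subseteq> Q \<Longrightarrow> R n Q'"
  obtains Q F where "silver_cube d Q" "Q \<subseteq> P"
    "\<And>n. finite (F n)" "\<And>n. F n \<subseteq> index_set d \<times> UNIV"
    "\<And>n x. R n (Q \<inter> agreeing_on (F n) x)"
proof -
  obtain h0 where h0: "silver_condition d h0" "P = cube d h0"
    using P by (auto simp: silver_cube_iff)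
  define good where "good = (\<lambda>(h, F). silver_condition d h \<and> cube d h \<subseteq> P \<and> finite F \<and>
    F \<subseteq> free_coordinates d h)"
  define step where "step = (\<lambda>n (h, F) (h', F'). cube d h' \<subseteq> cube d h \<and> F \<subseteq> F' \<and>
    (\<forall>x. R n (cube d h' \<inter> agreeing_on F x)) \<and> (\<forall>m\<in>index_set d. m \<le> n \<longrightarrow> (\<exists>k\<ge>n. (m, k) \<in> F')))"
  have "\<exists>s. \<forall>n. good (s n) \<and> step n (s n) (s (Suc n))"
  proof (rule dependent_nat_choice[where P = "\<lambda>_. good" and Q = step])
    show "\<exists>s. good s"
      using h0 by (intro exI[of _ "(h0, {})"]) (auto simp: good_def)
  next
    fix s n assume "good s"
    then obtain h F where s: "s = (h, F)" and h: "silver_condition d h" "cube d h \<subseteq> P"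
      "finite F" "F \<subseteq> free_coordinates d h"
      by (auto simp: good_def)
    have "\<exists>h'. silver_condition d h' \<and> cube d h' \<subseteq> cube d h \<and> F \<subseteq> free_coordinates d h' \<and>
        (\<forall>x. R n (cube d h' \<inter> agreeing_on F x))"
    proof (rule amalgamate[where R = "R n", OF h(1,3,4)])
      show "R n Q'" if "R n Q" "Q' \<subseteq> Q" for Q Q'
        using that by (rule down)
      show "\<exists>Q'. silver_cube d Q' \<and> Q' \<subseteq> Q \<and> R n Q'" if "silver_cube d Q" "Q \<subseteq> cube d h" for Q
        using that h(2) by (intro dense) auto
    qed
    then obtain h' where h': "silver_condition d h'" "cube d h' \<subseteq> cube d h"
      "F \<subseteq> free_coordinates d h'" "\<forall>x. R n (cube d h' \<inter> agreeing_on F x)"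
      by blast
    have "\<forall>m\<in>index_set d. \<exists>k\<ge>n. h' m k = None"
      using h'(1) unfolding silver_condition_def infinite_nat_iff_unbounded_le by (auto simp: domIff)
    then obtain k where k: "\<And>m. m \<in> index_set d \<Longrightarrow> k m \<ge> n \<and> h' m (k m) = None"
      by metis
    define F' where "F' = F \<union> (\<lambda>m. (m, k m)) ` (index_set d \<inter> {..n})"
    have good: "good (h', F')"
      using h h' k by (auto simp: good_def F'_def free_coordinates_def)
    have "(m, k m) \<in> F'" if "m \<in> index_set d" "m \<le> n" for m
      using that by (auto simp: F'_def)
    moreover have "F \<subseteq> F'"
      by (simp add: F'_def)
    ultimately have "step n s (h', F')"
      using h' k by (fastforce simp: step_def s)
    with good show "\<exists>t. good t \<and> step n s t" by blast
  qed
  then obtain s where s: "\<And>n. good (s n)" "\<And>n. step n (s n) (s (Suc n))"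
    by blast
  define h where "h = (\<lambda>n. fst (s n))"
  define F where "F = (\<lambda>n. snd (s n))"
  have good: "silver_condition d (h n)" "cube d (h n) \<subseteq> P" "finite (F n)"
    "F n \<subseteq> free_coordinates d (h n)" for n
    using s(1)[of n] by (auto simp: good_def h_def F_def split: prod.splits)
  have step: "cube d (h (Suc n)) \<subseteq> cube d (h n)" "F n \<subseteq> F (Suc n)"
    "R n (cube d (h (Suc n)) \<inter> agreeing_on (F n) x)"
    "m \<in> index_set d \<Longrightarrow> m \<le> n \<Longrightarrow> \<exists>k\<ge>n. (m, k) \<in> F (Suc n)" for n x m
    using s(2)[of n] by (auto simp: step_def h_def F_def split: prod.splits)
  have cube_anti: "cube d (h n') \<subseteq> cube d (h n)" if "n \<le> n'" for n n'
    using that step(1) by (rule lift_Suc_antimono_le[rotated])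
  have F_mono: "F n \<subseteq> F n'" if "n \<le> n'" for n n'
    using that step(2) by (rule lift_Suc_mono_le[rotated])
  have h_mono: "h n m \<subseteq>\<^sub>m h n' m" if "n \<le> n'" "m \<in> index_set d" for n n' m
    using that cube_anti by (intro cube_subset_imp_map_le) auto
  \<comment> \<open>The union of the increasing sequence of conditions; any stage that decides a coordinate gives
    the same value.\<close>
  define hs where "hs = (\<lambda>m k. if \<exists>n. h n m k \<noteq> None then h (LEAST n. h n m k \<noteq> None) m k else None)"
  have hs_le: "h n m \<subseteq>\<^sub>m hs m" if m: "m \<in> index_set d" for n m
    unfolding map_le_def
  proof
    fix k assume "k \<in> dom (h n m)"
    then have n: "h n m k \<noteq> None" by (simp add: domIff)
    define l where "l = (LEAST n. h n m k \<noteq> None)"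
    have "h l m k \<noteq> None" "l \<le> n"
      unfolding l_def using n by (auto intro: LeastI Least_le)
    then have "h l m k = h n m k"
      using h_mono[OF \<open>l \<le> n\<close> m] by (auto simp: map_le_def dom_def)
    then show "h n m k = hs m k"
      using n unfolding hs_def l_def by auto
  qed
  have F_free: "hs m k = None" if "(m, k) \<in> F n" for m k n
  proof -
    have "h n' m k = None" for n'
    proof -
      have "(m, k) \<in> F (max n n')"
        using that F_mono[of n "max n n'"] by auto
      then have *: "h (max n n') m k = None" "m \<in> index_set d"
        using good(4) by (auto simp: free_coordinates_def)
      then have "h n' m \<subseteq>\<^sub>m h (max n n') m"
        by (intro h_mono) auto
      then show ?thesis
        using * by (metis domIff map_le_def)
    qed
    then show ?thesis by (simp add: hs_def)
  qed
  have "silver_condition d hs"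
    unfolding silver_condition_def infinite_nat_iff_unbounded_le
  proof (intro ballI allI)
    fix m n assume "m \<in> index_set d"
    then obtain k where "k \<ge> max m n" "(m, k) \<in> F (Suc (max m n))"
      using step(4)[of m "max m n"] by auto
    then show "\<exists>k\<ge>n. k \<in> - dom (hs m)"
      using F_free by (intro exI[of _ k]) (auto simp: domIff)
  qed
  then have "silver_cube d (cube d hs)"
    by (auto simp: silver_cube_iff)
  have sub: "cube d hs \<subseteq> cube d (h n)" for n
    by (intro cube_mono hs_le)
  then have "cube d hs \<subseteq> P"
    using good(2) by blast
  have "R n (cube d hs \<inter> agreeing_on (F n) x)" for n x
    by (rule down[OF step(3)[of n x]]) (use sub[of "Suc n"] in blast)
  have "F n \<subseteq> index_set d \<times> UNIV" for n
    using good(4)[of n] by (auto simp: free_coordinates_def)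
  show ?thesis
    by (rule that[of "cube d hs" F]) fact+
qed

text \<open>Continuity is checked on the slices over the sets F n that fusion provides, because these are
  relatively open.\<close>

lemma continuous_map_on_cube:
  assumes "silver_cube d Q"
    and "\<And>n. finite (F n)" "\<And>n. F n \<subseteq> index_set d \<times> UNIV"
    and "g ` Q \<subseteq> topspace X"
    and basis: "\<And>x U. x \<in> Q \<Longrightarrow> openin X U \<Longrightarrow> g x \<in> U \<Longrightarrow> \<exists>n. g ` (Q \<inter> agreeing_on (F n) x) \<subseteq> U"
  shows "continuous_map (subtopology (cantor_power d) Q) X g"
proof -
  have top: "topspace (subtopology (cantor_power d) Q) = Q"
    using silver_cube_subset_topspace[OF assms(1)] by auto
  show ?thesis
    unfolding continuous_map_def top
  proof (intro conjI allI impI)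
    show "g \<in> Q \<rightarrow> topspace X" using assms(4) by auto
    fix U assume U: "openin X U"
    show "openin (subtopology (cantor_power d) Q) {x \<in> Q. g x \<in> U}"
    proof (subst openin_subopen, intro ballI)
      fix x assume x: "x \<in> {x \<in> Q. g x \<in> U}"
      then obtain n where n: "g ` (Q \<inter> agreeing_on (F n) x) \<subseteq> U"
        using basis U by blast
      show "\<exists>T. openin (subtopology (cantor_power d) Q) T \<and> x \<in> T \<and> T \<subseteq> {x \<in> Q. g x \<in> U}"
        using n x openin_subtopology_agreeing_on[OF assms(1) assms(2)[of n] assms(3)[of n], of x]
        by (intro exI[of _ "Q \<inter> agreeing_on (F n) x"]) (auto simp: agreeing_on_def)
    qed
  qed
qed


section \<open>Countable covers of a Silver cube\<close>

text \<open>
  Otherwise each A n could be avoided by a subcube of every cube inside P, and fusion would produce one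
  subcube of P avoiding all A n, contrary to the covering. In other words, the sets that can
  be avoided by a subcube of every cube form a \<open>\<sigma>\<close>-ideal.
\<close>

lemma subcube_inside_countable_cover:
  fixes A :: "nat \<Rightarrow> (nat \<Rightarrow> nat \<Rightarrow> bool) set"
  assumes P: "silver_cube d P" and A: "\<And>n. v_property d (A n)" and cover: "P \<subseteq> (\<Union>n. A n)"
  obtains n Q where "silver_cube d Q" "Q \<subseteq> P" "Q \<subseteq> A n"
proof (rule ccontr)
  assume "\<not> thesis"
  then have none: "\<not> Q \<subseteq> A n" if "silver_cube d Q" "Q \<subseteq> P" for Q n
    using that \<open>\<And>Q n. silver_cube d Q \<Longrightarrow> Q \<subseteq> P \<Longrightarrow> Q \<subseteq> A n \<Longrightarrow> thesis\<close> by blast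
  have dense: "\<exists>Q'. silver_cube d Q' \<and> Q' \<subseteq> Q \<and> Q' \<inter> A n = {}"
    if Q: "silver_cube d Q" "Q \<subseteq> P" for n Q
  proof -
    obtain Q' where Q': "silver_cube d Q'" "Q' \<subseteq> Q"
      "Q' \<subseteq> A n \<or> Q' \<subseteq> topspace (cantor_power d) - A n"
      using A[of n] Q(1) unfolding v_property_def by blast
    then have "Q' \<inter> A n = {}"
      using none[of Q' n] Q(2) by blast
    with Q' show ?thesis by blast
  qed
  obtain Q F where Q: "silver_cube d Q" "Q \<subseteq> P"
    "\<And>n x. (Q \<inter> agreeing_on (F n) x) \<inter> A n = {}"
    by (rule fusion[where R = "\<lambda>n Q. Q \<inter> A n = {}", OF P dense]) auto
  obtain x where x: "x \<in> Q"
    using silver_cube_nonempty[OF Q(1)] by blast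
  then obtain n where "x \<in> A n"
    using Q(2) cover by blast
  then show False
    using x Q(3)[of n x] by (auto simp: agreeing_on_def)
qed


section \<open>Cardinality of continuous images\<close>

lemma compactin_cylinder: "compactin cantor_topology (cylinder h)"
proof -
  have "cylinder h = (\<Pi>\<^sub>E n\<in>UNIV. case h n of None \<Rightarrow> UNIV | Some b \<Rightarrow> {b})"
    by (force simp: cylinder_def PiE_iff dom_def split: option.splits)
  then show ?thesis
    unfolding cantor_topology_def by (simp add: compactin_PiE compactin_discrete_topology)
qed

lemma compactin_silver_cube: "silver_cube d Q \<Longrightarrow> compactin (cantor_power d) Q"
  unfolding silver_cube_def cantor_power_def
  by (elim exE conjE, hypsubst, subst compactin_PiE) (simp add: compactin_cylinder)

text \<open>
  The image is compact, hence closed, and has no isolated point: the slice of Q around a preimage of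
  an isolated point would be a Silver cube with constant image. So the image is a nonempty
  perfect set.
\<close>

lemma continuum_lepoll_image_of_cube:
  assumes Q: "silver_cube d Q"
    and X: "compact_space X" "Hausdorff_space X"
    and F: "\<And>n. finite (F n)" "\<And>n. F n \<subseteq> index_set d \<times> UNIV"
    and g: "g ` Q \<subseteq> topspace X"
    and basis: "\<And>x U. x \<in> Q \<Longrightarrow> openin X U \<Longrightarrow> g x \<in> U \<Longrightarrow> \<exists>n. g ` (Q \<inter> agreeing_on (F n) x) \<subseteq> U"
    and nonconstant: "\<And>Q' c. silver_cube d Q' \<Longrightarrow> Q' \<subseteq> Q \<Longrightarrow> \<not> g ` Q' \<subseteq> {c}"
  shows "(UNIV :: real set) \<lesssim> g ` Q"
proof (rule lepoll_perfect_set)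
  show "completely_metrizable_space X \<or> locally_compact_space X \<and> Hausdorff_space X"
    using X compact_imp_locally_compact_space by blast
  show "g ` Q \<noteq> {}"
    using silver_cube_nonempty[OF Q] by simp
  have "continuous_map (subtopology (cantor_power d) Q) X g"
    by (rule continuous_map_on_cube[OF Q F g basis])
  moreover have "compactin (subtopology (cantor_power d) Q) Q"
    using compactin_silver_cube[OF Q] by (simp add: compactin_subtopology)
  ultimately have "compactin X (g ` Q)"
    by (rule image_compactin[rotated])
  then have "closedin X (g ` Q)"
    using X compactin_imp_closedin by blast
  then have "X derived_set_of (g ` Q) \<subseteq> g ` Q"
    by (simp add: closedin_contains_derived_set)
  moreover have "g x \<in> X derived_set_of (g ` Q)" if x: "x \<in> Q" for x
    unfolding in_derived_set_of
  proof (intro conjI allI impI)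
    show "g x \<in> topspace X"
      using g x by blast
    fix U assume "g x \<in> U \<and> openin X U"
    then obtain n where n: "g ` (Q \<inter> agreeing_on (F n) x) \<subseteq> U"
      using basis x by blast
    have "\<not> g ` (Q \<inter> agreeing_on (F n) x) \<subseteq> {g x}"
      using silver_cube_agreeing_on[OF Q x F(1,2)] by (intro nonconstant) auto
    then show "\<exists>y. y \<noteq> g x \<and> y \<in> g ` Q \<and> y \<in> U"
      using n by blast
  qed
  ultimately show "X derived_set_of (g ` Q) = g ` Q"
    by blast
qed

text \<open>Conditions are paired with a truth value because two points will be selected for each
  cube. A pair is coded by the countable graph of its condition, with one extra element
  recording the truth value.\<close>

lemma conditions_lepoll_continuum:
  "(UNIV :: ((nat \<Rightarrow> nat \<rightharpoonup> bool) \<times> bool) set) \<lesssim> (UNIV :: real set)"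
proof -
  define graph where "graph = (\<lambda>(h :: nat \<Rightarrow> nat \<rightharpoonup> bool, b).
    {Some (m, k, c) |m k c. h m k = Some c} \<union> (if b then {None} else {}))"
  have "inj graph"
  proof (rule injI)
    fix p q assume eq: "graph p = graph q"
    obtain h b h' b' where pq: "p = (h, b)" "q = (h', b')"
      by fastforce
    have "h m k = Some c \<longleftrightarrow> h' m k = Some c" for m k c
      using arg_cong[OF eq, of "\<lambda>S. Some (m, k, c) \<in> S"] by (simp add: graph_def pq split: if_splits)
    then have "h m k = h' m k" for m k
      by (metis option.exhaust)
    moreover have "b \<longleftrightarrow> b'"
      using arg_cong[OF eq, of "\<lambda>S. None \<in> S"] by (simp add: graph_def pq split: if_splits)
    ultimately show "p = q"
      by (auto simp: pq)
  qed
  then have "inj (\<lambda>p. to_nat ` graph p)"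
    by (auto simp: inj_def inj_image_eq_iff)
  then have "(UNIV :: ((nat \<Rightarrow> nat \<rightharpoonup> bool) \<times> bool) set) \<lesssim> (UNIV :: nat set set)"
    unfolding lepoll_def by blast
  also have "\<dots> \<lesssim> (UNIV :: real set)"
    using nat_sets_eqpoll_reals eqpoll_imp_lepoll by blast
  finally show ?thesis .
qed


section \<open>A Bernstein-type selection\<close>

text \<open>
  Transfinite recursion along a well-order of A of minimal length: at each stage fewer than card A
  values are used up, so some element of S a is still available.
\<close>

lemma injective_choice:
  assumes large: "\<And>a. a \<in> A \<Longrightarrow> A \<lesssim> S a"
  obtains \<phi> where "inj_on \<phi> A" "\<And>a. a \<in> A \<Longrightarrow> \<phi> a \<in> S a"
proof -
  let ?r = "card_of A"
  have wo: "well_order_on A ?r"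
    by (rule card_of_well_order_on)
  have wf: "wf (?r - Id)"
    using wo by (simp add: well_order_on_def)
  define \<phi> where "\<phi> = wfrec (?r - Id) (\<lambda>\<phi> a. SOME y. y \<in> S a - \<phi> ` underS ?r a)"
  have \<phi>_eq: "\<phi> a = (SOME y. y \<in> S a - \<phi> ` underS ?r a)" for a
  proof -
    have "cut \<phi> (?r - Id) a ` underS ?r a = \<phi> ` underS ?r a"
      by (intro image_cong) (auto simp: cut_def underS_def)
    then show ?thesis
      unfolding \<phi>_def by (subst wfrec[OF wf]) (simp add: \<phi>_def)
  qed
  have \<phi>: "\<phi> a \<in> S a - \<phi> ` underS ?r a" if a: "a \<in> A" for a
  proof -
    have "(card_of (\<phi> ` underS ?r a), card_of (underS ?r a)) \<in> ordLeq"
      by (rule card_of_image)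
    moreover have "(card_of (underS ?r a), ?r) \<in> ordLess"
      using a by (intro card_of_underS card_of_Card_order) (simp add: Field_card_of)
    moreover have "(?r, card_of (S a)) \<in> ordLeq"
      using large[OF a] by (simp add: lepoll_def card_of_ordLeq)
    ultimately have "(card_of (\<phi> ` underS ?r a), card_of (S a)) \<in> ordLess"
      using ordLeq_ordLess_trans ordLess_ordLeq_trans by blast
    then have "\<not> S a \<subseteq> \<phi> ` underS ?r a"
      using card_of_mono1 not_ordLess_ordLeq by blast
    then have "\<exists>y. y \<in> S a - \<phi> ` underS ?r a"
      by blast
    then show ?thesis
      by (subst \<phi>_eq) (rule someI_ex)
  qed
  have "inj_on \<phi> A"
  proof (rule inj_onI, rule ccontr)
    fix a b assume ab: "a \<in> A" "b \<in> A" "\<phi> a = \<phi> b" "a \<noteq> b"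
    then have "a \<in> underS ?r b \<or> b \<in> underS ?r a"
      using wo unfolding well_order_on_def linear_order_on_def total_on_def underS_def by blast
    then show False
      using ab \<phi> by (metis DiffD2 imageI)
  qed
  with \<phi> show ?thesis
    using that by blast
qed

text \<open>
  For maps into the Cantor space, measurability of the sets of points where the coordinate n of g is
  true suffices to make g continuous by fusion. If g were constant on no subcube, the Bernstein set
  built from the images of all subcubes would have a preimage that is not measurable.
\<close>

lemma constant_on_subcube_cantor_valued:
  fixes g :: "(nat \<Rightarrow> nat \<Rightarrow> bool) \<Rightarrow> nat \<Rightarrow> bool"
  assumes P: "silver_cube d P"
    and measurable: "\<And>J Q. silver_cube d Q \<Longrightarrow> Q \<subseteq> P \<Longrightarrow>
      \<exists>Q'. silver_cube d Q' \<and> Q' \<subseteq> Q \<and> (g ` Q' \<subseteq> J \<or> g ` Q' \<inter> J = {})"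
  obtains Q c where "silver_cube d Q" "Q \<subseteq> P" "g ` Q \<subseteq> {c}"
proof (rule ccontr)
  assume "\<not> thesis"
  then have nonconstant: "\<not> g ` Q \<subseteq> {c}" if "silver_cube d Q" "Q \<subseteq> P" for Q c
    using that \<open>\<And>Q c. silver_cube d Q \<Longrightarrow> Q \<subseteq> P \<Longrightarrow> g ` Q \<subseteq> {c} \<Longrightarrow> thesis\<close> by blast
  have dense: "\<exists>Q'. silver_cube d Q' \<and> Q' \<subseteq> Q \<and> (\<forall>x\<in>Q'. \<forall>y\<in>Q'. g x n = g y n)"
    if "silver_cube d Q" "Q \<subseteq> P" for n Q
    using measurable[OF that, of "{z. z n}"] by blast
  obtain Q F where Q: "silver_cube d Q" "Q \<subseteq> P"
    and F: "\<And>n. finite (F n)" "\<And>n. F n \<subseteq> index_set d \<times> UNIV"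
    and gF: "\<And>n z. \<forall>x\<in>Q \<inter> agreeing_on (F n) z. \<forall>y\<in>Q \<inter> agreeing_on (F n) z. g x n = g y n"
    by (rule fusion[where R = "\<lambda>n Q. \<forall>x\<in>Q. \<forall>y\<in>Q. g x n = g y n", OF P dense]) (blast+)
  \<comment> \<open>Basic open sets of the Cantor space constrain finitely many coordinates, so the sets F n are
    accumulated.\<close>
  define G where "G = (\<lambda>n. \<Union>i\<le>n. F i)"
  have G: "finite (G n)" "G n \<subseteq> index_set d \<times> UNIV" for n
    using F by (auto simp: G_def)
  have basis: "\<exists>n. g ` (Q \<inter> agreeing_on (G n) x) \<subseteq> U"
    if x: "x \<in> Q" and U: "openin cantor_topology U" "g x \<in> U" for x U
  proof -
    obtain V where V: "finite {i. V i \<noteq> (UNIV :: bool set)}" "g x \<in> Pi\<^sub>E UNIV V" "Pi\<^sub>E UNIV V \<subseteq> U"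
      using U unfolding cantor_topology_def openin_product_topology_alt by auto
    obtain n where n: "\<And>i. V i \<noteq> UNIV \<Longrightarrow> i \<le> n"
      using V(1) unfolding finite_nat_set_iff_bounded_le by blast
    have "g y \<in> Pi\<^sub>E UNIV V" if y: "y \<in> Q \<inter> agreeing_on (G n) x" for y
    proof -
      have "g y i \<in> V i" for i
      proof (cases "V i = UNIV")
        case False
        then have "F i \<subseteq> G n"
          using n by (auto simp: G_def)
        then have "y \<in> agreeing_on (F i) x"
          using y by (auto simp: agreeing_on_def)
        moreover have "x \<in> agreeing_on (F i) x"
          by (auto simp: agreeing_on_def)
        ultimately have "g y i = g x i"
          using gF[of i x] x y by blast
        then show ?thesis
          using V(2) by (auto simp: PiE_iff)
      qed auto
      then show ?thesis by (simp add: PiE_iff)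
    qed
    with V(3) show ?thesis by blast
  qed
  define A where "A = {h. silver_condition d h \<and> cube d h \<subseteq> Q} \<times> (UNIV :: bool set)"
  have "A \<lesssim> g ` cube d h" if h: "silver_condition d h" "cube d h \<subseteq> Q" for h
  proof -
    have "A \<lesssim> (UNIV :: ((nat \<Rightarrow> nat \<rightharpoonup> bool) \<times> bool) set)"
      by (simp add: subset_imp_lepoll)
    also note conditions_lepoll_continuum
    also have "(UNIV :: real set) \<lesssim> g ` cube d h"
    proof (rule continuum_lepoll_image_of_cube[OF _ _ _ G])
      show "silver_cube d (cube d h)"
        using h by (auto simp: silver_cube_iff)
      show "compact_space cantor_topology" "Hausdorff_space cantor_topology"
        by (simp_all add: cantor_topology_def compact_space_product_topology
            compact_space_discrete_topology Hausdorff_space_product_topology)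
      show "g ` cube d h \<subseteq> topspace cantor_topology"
        by (simp add: cantor_topology_def)
      show "\<exists>n. g ` (cube d h \<inter> agreeing_on (G n) x) \<subseteq> U"
        if "x \<in> cube d h" "openin cantor_topology U" "g x \<in> U" for x U
        using basis[of x U] that h by blast
      show "\<not> g ` Q' \<subseteq> {c}" if "silver_cube d Q'" "Q' \<subseteq> cube d h" for Q' c
        using that h Q by (intro nonconstant) auto
    qed
    finally show ?thesis .
  qed
  then have large: "A \<lesssim> g ` cube d (fst a)" if "a \<in> A" for a
    using that by (auto simp: A_def)
  obtain \<phi> where \<phi>: "inj_on \<phi> A" "\<And>a. a \<in> A \<Longrightarrow> \<phi> a \<in> g ` cube d (fst a)"
    by (rule injective_choice[of A "\<lambda>a. g ` cube d (fst a)", OF large]) blast+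
  define B where "B = \<phi> ` {a \<in> A. snd a}"
  obtain Q' where Q': "silver_cube d Q'" "Q' \<subseteq> Q" "g ` Q' \<subseteq> B \<or> g ` Q' \<inter> B = {}"
    using measurable[OF Q] by blast
  then obtain h where h: "Q' = cube d h" "(h, True) \<in> A" "(h, False) \<in> A"
    by (auto simp: silver_cube_iff A_def)
  have "\<phi> (h, True) \<in> g ` Q' \<inter> B"
    using \<phi>(2)[OF h(2)] h(1,2) by (auto simp: B_def)
  moreover have "\<phi> (h, False) \<in> g ` Q'" 
    using \<phi>(2)[OF h(3)] h(1) by simp
  moreover have "\<phi> (h, False) \<notin> B"
    using inj_onD[OF \<phi>(1)] h(3) by (fastforce simp: B_def)
  ultimately show False
    using Q'(3) by blast
qed

text \<open>The set of values on P has at most as many elements as P, so it embeds into the Cantor space.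
  Any embedding will do, since the preimages of all sets of values are measurable.\<close>

lemma constant_on_subcube:
  assumes P: "silver_cube d P"
    and measurable: "\<And>J Q. silver_cube d Q \<Longrightarrow> Q \<subseteq> P \<Longrightarrow>
      \<exists>Q'. silver_cube d Q' \<and> Q' \<subseteq> Q \<and> (g ` Q' \<subseteq> J \<or> g ` Q' \<inter> J = {})"
  obtains Q c where "silver_cube d Q" "Q \<subseteq> P" "g ` Q \<subseteq> {c}"
proof -
  \<comment> \<open>A value is coded by a point of P mapped to it, read as a single sequence.\<close>
  define e where "e = (\<lambda>i k. case_prod (inv_into P g i) (prod_decode k))"
  have "inj_on e (g ` P)"
  proof (rule inj_onI)
    fix i j assume ij: "i \<in> g ` P" "j \<in> g ` P" "e i = e j"
    have "inv_into P g i m k = inv_into P g j m k" for m k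
      using fun_cong[OF ij(3), of "prod_encode (m, k)"] by (simp add: e_def)
    then have "inv_into P g i = inv_into P g j"
      by blast
    with ij show "i = j"
      by (metis f_inv_into_f)
  qed
  have "\<exists>Q'. silver_cube d Q' \<and> Q' \<subseteq> Q \<and> ((e \<circ> g) ` Q' \<subseteq> J \<or> (e \<circ> g) ` Q' \<inter> J = {})"
    if "silver_cube d Q" "Q \<subseteq> P" for J Q
    using measurable[OF that, of "e -` J"] by (auto simp: image_subset_iff disjoint_iff)
  then obtain Q c where Q: "silver_cube d Q" "Q \<subseteq> P" "(e \<circ> g) ` Q \<subseteq> {c}"
    using constant_on_subcube_cantor_valued[OF P, of "e \<circ> g"] by metis
  obtain x where x: "x \<in> Q"
    using silver_cube_nonempty[OF Q(1)] by blast
  have "g y = g x" if "y \<in> Q" for y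
    using inj_onD[OF \<open>inj_on e (g ` P)\<close>, of "g y" "g x"] Q that x by (auto simp: image_subset_iff)
  then show ?thesis
    using that[OF Q(1,2), of "g x"] by blast
qed


section \<open>Decomposing a metric space into small open pieces\<close>

text \<open>
  Stone's construction in Rudin's form. Well-order M and assign each point to the first ball of radius e
  containing it; let C n y consist of the points assigned to y that have a margin of
  3/(n+1) in that ball. Points of C n y and of C n z are at least 3/(n+1) apart when y \<open>\<noteq>\<close> z, so enlarging each C n y
  by 1/(n+1) gives disjoint open sets that stay inside the balls.
\<close>

lemma (in Metric_space) sigma_disjoint_open_cover:
  assumes "0 < e"
  obtains E :: "nat \<Rightarrow> 'a \<Rightarrow> 'a set" where
    "\<And>n y. openin mtopology (E n y)"
    "\<And>n y. y \<in> M \<Longrightarrow> E n y \<subseteq> mball y e"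
    "\<And>n y z. y \<in> M \<Longrightarrow> z \<in> M \<Longrightarrow> y \<noteq> z \<Longrightarrow> E n y \<inter> E n z = {}"
    "M \<subseteq> (\<Union>n. \<Union>y\<in>M. E n y)"
proof -
  obtain r where r: "well_order_on M r"
    using well_order_on by blast
  define C where "C = (\<lambda>n y. {x \<in> M. d y x \<le> e - 3 / real (Suc n) \<and> (\<forall>z\<in>underS r y. e \<le> d z x)})"
  define E where "E = (\<lambda>n y. \<Union>x\<in>C n y. mball x (1 / real (Suc n)))"
  have separated: "E n y \<inter> E n z = {}" if yz: "y \<in> M" "z \<in> M" "y \<in> underS r z" for n y z
  proof (rule equals0I)
    fix w assume "w \<in> E n y \<inter> E n z"
    then obtain x x' where x: "x \<in> C n y" "w \<in> mball x (1 / real (Suc n))"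
      and x': "x' \<in> C n z" "w \<in> mball x' (1 / real (Suc n))"
      by (auto simp: E_def)
    have "e \<le> d y x'"
      using x'(1) yz by (auto simp: C_def)
    also have "\<dots> \<le> d y x + d x w + d w x'"
      using triangle[of y x x'] triangle[of x w x'] x x' yz by (auto simp: C_def)
    also have "\<dots> < (e - 3 / real (Suc n)) + 1 / real (Suc n) + 1 / real (Suc n)"
      using x x' by (auto simp: C_def commute)
    also have "\<dots> \<le> e"
      by (simp add: field_simps)
    finally show False by simp
  qed
  show thesis
  proof
    show "openin mtopology (E n y)" for n y
      by (auto simp: E_def)
    show "E n y \<subseteq> mball y e" if "y \<in> M" for n y
    proof
      fix w assume "w \<in> E n y"
      then obtain x where x: "x \<in> C n y" "w \<in> mball x (1 / real (Suc n))"
        by (auto simp: E_def)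
      have "d y w \<le> d y x + d x w"
        using triangle[of y x w] x that by (auto simp: C_def)
      also have "\<dots> < (e - 3 / real (Suc n)) + 1 / real (Suc n)"
        using x by (auto simp: C_def)
      also have "\<dots> \<le> e"
        by (simp add: field_simps)
      finally show "w \<in> mball y e"
        using x that by auto
    qed
    show "E n y \<inter> E n z = {}" if "y \<in> M" "z \<in> M" "y \<noteq> z" for n y z
    proof -
      have "y \<in> underS r z \<or> z \<in> underS r y"
        using r that unfolding well_order_on_def linear_order_on_def total_on_def underS_def by blast
      then show ?thesis
        using separated that by blast
    qed
    show "M \<subseteq> (\<Union>n. \<Union>y\<in>M. E n y)"
    proof
      fix x assume x: "x \<in> M"
      have "wf (r - Id)"
        using r by (simp add: well_order_on_def)
      moreover have "x \<in> {y \<in> M. d y x < e}"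
        using x assms by simp
      ultimately obtain y where y: "y \<in> M" "d y x < e"
        and least: "\<And>z. (z, y) \<in> r - Id \<Longrightarrow> z \<notin> {y \<in> M. d y x < e}"
        by (rule wfE_min) auto
      obtain n where n: "inverse (real (Suc n)) < (e - d y x) / 3"
        using reals_Archimedean[of "(e - d y x) / 3"] y(2) by auto
      have "z \<in> M" if "z \<in> underS r y" for z
        using that r unfolding underS_def well_order_on_def linear_order_on_def partial_order_on_def
          preorder_on_def refl_on_def by blast
      then have "\<forall>z\<in>underS r y. e \<le> d z x"
        using least by (force simp: underS_def)
      moreover have "d y x \<le> e - 3 / real (Suc n)"
        using n by (simp add: field_simps)
      ultimately have "x \<in> C n y"
        using x by (simp add: C_def)
      moreover have "x \<in> mball x (1 / real (Suc n))"
        using x by simp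
      ultimately show "x \<in> (\<Union>n. \<Union>y\<in>M. E n y)"
        using y unfolding E_def by blast
    qed
  qed
qed


section \<open>Measurable functions have small images on small cubes\<close>

text \<open>
  On a subcube f takes values in a single disjoint family of open sets; arbitrary unions of its
  members are open, so the index g x of the member containing f x has all its preimages measurable
  and is constant on a smaller cube.
\<close>

lemma (in Metric_space) subcube_with_small_image:
  assumes f: "v_measurable \<delta> mtopology f" and P: "silver_cube \<delta> P" and "0 < e"
  obtains Q y where "silver_cube \<delta> Q" "Q \<subseteq> P" "y \<in> M" "f ` Q \<subseteq> mball y e"
proof -
  have f_M: "f x \<in> M" if "x \<in> topspace (cantor_power \<delta>)" for x
    using f that by (auto simp: v_measurable_def)
  have preimage: "v_property \<delta> {x \<in> topspace (cantor_power \<delta>). f x \<in> U}" if "openin mtopology U" for U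
    using f that by (auto simp: v_measurable_def)
  obtain E :: "nat \<Rightarrow> 'a \<Rightarrow> 'a set" where E: "\<And>n y. openin mtopology (E n y)"
    "\<And>n y. y \<in> M \<Longrightarrow> E n y \<subseteq> mball y e"
    "\<And>n y z. y \<in> M \<Longrightarrow> z \<in> M \<Longrightarrow> y \<noteq> z \<Longrightarrow> E n y \<inter> E n z = {}"
    "M \<subseteq> (\<Union>n. \<Union>y\<in>M. E n y)"
    using sigma_disjoint_open_cover[OF \<open>0 < e\<close>] by metis
  define A where "A = (\<lambda>n. {x \<in> topspace (cantor_power \<delta>). f x \<in> (\<Union>y\<in>M. E n y)})"
  have "v_property \<delta> (A n)" for n
    unfolding A_def using E(1) by (intro preimage) auto
  moreover have "P \<subseteq> (\<Union>n. A n)"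
    using silver_cube_subset_topspace[OF P] f_M E(4) by (fastforce simp: A_def)
  ultimately obtain n Q where Q: "silver_cube \<delta> Q" "Q \<subseteq> P" "Q \<subseteq> A n"
    using subcube_inside_countable_cover[OF P] by metis
  define g where "g = (\<lambda>x. SOME y. y \<in> M \<and> f x \<in> E n y)"
  have g: "g x \<in> M \<and> f x \<in> E n (g x)" if "x \<in> Q" for x
  proof -
    have "\<exists>y. y \<in> M \<and> f x \<in> E n y"
      using Q(3) that by (auto simp: A_def)
    then show ?thesis
      unfolding g_def by (rule someI_ex)
  qed
  have "\<exists>Q'. silver_cube \<delta> Q' \<and> Q' \<subseteq> Q1 \<and> (g ` Q' \<subseteq> J \<or> g ` Q' \<inter> J = {})"
    if Q1: "silver_cube \<delta> Q1" "Q1 \<subseteq> Q" for J Q1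
  proof -
    let ?U = "\<Union>y\<in>M \<inter> J. E n y"
    have "v_property \<delta> {x \<in> topspace (cantor_power \<delta>). f x \<in> ?U}"
      using E(1) by (intro preimage) auto
    then obtain Q' where Q': "silver_cube \<delta> Q'" "Q' \<subseteq> Q1"
      "(\<forall>x\<in>Q'. f x \<in> ?U) \<or> (\<forall>x\<in>Q'. f x \<notin> ?U)"
      using Q1(1) unfolding v_property_def by (smt (verit) DiffD2 mem_Collect_eq subset_iff DiffD1)
    have "f x \<in> ?U \<longleftrightarrow> g x \<in> J" if "x \<in> Q'" for x
    proof -
      have "g x \<in> M" "f x \<in> E n (g x)"
        using g that Q'(2) Q1(2) by auto
      then show ?thesis
        using E(3)[of _ "g x" n] by blast
    qed
    with Q' show ?thesis by blast
  qed
  then obtain Q' y where Q': "silver_cube \<delta> Q'" "Q' \<subseteq> Q" "g ` Q' \<subseteq> {y}"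
    using constant_on_subcube[OF Q(1), of g] by metis
  have "f x \<in> E n y \<and> y \<in> M" if "x \<in> Q'" for x
    using g[of x] Q'(2,3) that by auto
  moreover obtain x where "x \<in> Q'"
    using silver_cube_nonempty[OF Q'(1)] by blast
  ultimately have "y \<in> M" "f ` Q' \<subseteq> mball y e"
    using E(2)[of y n] by auto
  then show ?thesis
    using that Q(2) Q'(1,2) by blast
qed

section \<open>Continuity on a Silver cube\<close>

theorem theorem4:
  fixes d :: enat
    and Y :: "'y set" and dist_Y :: "'y \<Rightarrow> 'y \<Rightarrow> real"
    and f :: "(nat \<Rightarrow> nat \<Rightarrow> bool) \<Rightarrow> 'y"
    and P :: "(nat \<Rightarrow> nat \<Rightarrow> bool) set"
  assumes "Metric_space Y dist_Y"
    and "v_measurable d (Metric_space.mtopology Y dist_Y) f"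
    and "silver_cube d P"
  shows "\<exists>Q. silver_cube d Q \<and> Q \<subseteq> P \<and>
    continuous_map (subtopology (cantor_power d) Q) (Metric_space.mtopology Y dist_Y) f"
proof -
  interpret Metric_space Y dist_Y by fact
  define small where "small = (\<lambda>n Q. \<exists>y\<in>Y. f ` Q \<subseteq> mball y (1 / real (Suc n)))"
  have dense: "\<exists>Q'. silver_cube d Q' \<and> Q' \<subseteq> Q \<and> small n Q'" if Q: "silver_cube d Q" for n Q
  proof -
    obtain Q' y where "silver_cube d Q'" "Q' \<subseteq> Q" "y \<in> Y" "f ` Q' \<subseteq> mball y (1 / real (Suc n))"
      using subcube_with_small_image[OF assms(2) Q, of "1 / real (Suc n)"] by auto
    then show ?thesis
      unfolding small_def by blast
  qed
  have down: "small n Q'" if "small n Q" "Q' \<subseteq> Q" for n Q Q'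
    using that unfolding small_def by blast
  obtain Q F where Q: "silver_cube d Q" "Q \<subseteq> P"
    and F: "\<And>n. finite (F n)" "\<And>n. F n \<subseteq> index_set d \<times> UNIV"
    and small: "\<And>n x. small n (Q \<inter> agreeing_on (F n) x)"
    by (rule fusion[where R = small, OF assms(3) dense down]) blast+
  have "continuous_map (subtopology (cantor_power d) Q) mtopology f"
  proof (rule continuous_map_on_cube[OF Q(1) F])
    show "f ` Q \<subseteq> topspace mtopology"
      using assms(2) silver_cube_subset_topspace[OF Q(1)] unfolding v_measurable_def by blast
    fix x U assume x: "x \<in> Q" and U: "openin mtopology U" "f x \<in> U"
    then obtain e where e: "e > 0" "mball (f x) e \<subseteq> U"
      unfolding openin_mtopology by blast
    obtain n where n: "inverse (real (Suc n)) < e / 2"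
      using reals_Archimedean[of "e / 2"] e(1) by auto
    obtain y where y: "y \<in> Y" "f ` (Q \<inter> agreeing_on (F n) x) \<subseteq> mball y (1 / real (Suc n))"
      using small unfolding small_def by blast
    have fx: "f x \<in> mball y (1 / real (Suc n))"
      using y(2) x by (auto simp: agreeing_on_def)
    have "mball y (1 / real (Suc n)) \<subseteq> mball (f x) e"
    proof
      fix w assume w: "w \<in> mball y (1 / real (Suc n))"
      have "dist_Y (f x) w \<le> dist_Y y (f x) + dist_Y y w"
        using triangle''[of "f x" y w] fx w by (auto simp: commute)
      also have "\<dots> < e"
        using fx w n by (auto simp: inverse_eq_divide)
      finally show "w \<in> mball (f x) e"
        using fx w by auto
    qed
    with y(2) e(2) show "\<exists>n. f ` (Q \<inter> agreeing_on (F n) x) \<subseteq> U"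
      by blast
  qed
  with Q show ?thesis by blast
qed

end
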